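(* For all integers $n,k$ with $n\ge k\ge 1$ and $n-k\ge 1$, the binomial Ward numbers of the first kind $A^\circ(n,k)$ satisfy $$A^\circ(n,k)=\frac{2n(2n-1)}{n+k}\left(\frac{n+k-1}{n-k}\,A^\circ(n-1,k)+A^\circ(n-1,k-1)\right),$$ with $A^\circ(0,0)=1$, $A^\circ(n,0)=0$ for $n\ge1$, $A^\circ(0,k)=0$ for $k\ge1$, and $A^\circ(n,k)=0$ for $k>n$.
   Context: Ward numbers of the first kind $A(n,k)$: defined for $n\ge k\ge 1$ by the recurrence $A(n,k)=(n+k-1)\big(A(n-1,k)+A(n-1,k-1)\big)$, with $A(0,0)=1$, $A(n,0)=0$ for $n\ge 1$, $A(0,k)=0$ for $k\ge 1$, and $A(n,k)=0$ for $k>n$. Binomial Ward numbers of the first kind: for integers $n,k\ge 0$, $A^\circ(n,k)=\dbinom{2n}{n+k}A(n,k)$. *)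

theory Defs
  imports Complex_Main
begin

text \<open>Ward numbers of the first kind. In the last equation the arguments are shifted by one, so
  the factor \<open>n + k + 1\<close> is the usual \<open>n + k - 1\<close>; see \<open>ward1_rec\<close> below for the unshifted form.\<close>

fun ward1 :: "nat \<Rightarrow> nat \<Rightarrow> nat" where
  "ward1 0 0 = 1"
| "ward1 (Suc n) 0 = 0"
| "ward1 0 (Suc k) = 0"
| "ward1 (Suc n) (Suc k) =
     (if Suc k > Suc n then 0 else (n + k + 1) * (ward1 n (Suc k) + ward1 n k))"

lemma ward1_rec:
  assumes "n \<ge> k" and "k \<ge> 1"
  shows "ward1 n k = (n + k - 1) * (ward1 (n - 1) k + ward1 (n - 1) (k - 1))"
  using assms by (cases n; cases k) auto

lemma ward1_eq_0: "k > n \<Longrightarrow> ward1 n k = 0"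
  by (cases n; cases k) auto

definition binomial_ward1 :: "nat \<Rightarrow> nat \<Rightarrow> nat" where
  "binomial_ward1 n k = ((2 * n) choose (n + k)) * ward1 n k"

end

theory Submission
  imports Defs
begin

text \<open>Multiply the Ward recurrence by (2n choose n+k). Each of the two resulting terms should
  carry the binomial with upper index 2n-2 that belongs to it, and that binomial differs from (2n
  choose n+k) by a rational factor. For A(n-1,k-1) the lower index drops by 2, with factor
  2n(2n-1)/((n+k)(n+k-1)), whose n+k-1 cancels the one in the recurrence. For A(n-1,k) it drops by
  1, with factor 2n(2n-1)/((n+k)(n-k)), so n+k-1 survives over n-k. The two absorption lemmas supply
  these factors without division. The boundary values are inherited from
  \<open>ward1\<close>.\<close>

lemma binomial_Suc_Suc_absorb:
  "(j + 2) * (j + 1) * (N + 2 choose (j + 2)) = (N + 2) * (N + 1) * (N choose j)"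
proof -
  have "(j + 2) * (N + 2 choose (j + 2)) = (N + 2) * (N + 1 choose (j + 1))"
    using Suc_times_binomial_eq[of "N + 1" "j + 1"] by (simp add: mult.commute)
  moreover have "(j + 1) * (N + 1 choose (j + 1)) = (N + 1) * (N choose j)"
    using Suc_times_binomial_eq[of N j] by (simp add: mult.commute)
  ultimately show ?thesis
    by (metis mult.assoc mult.left_commute)
qed

text \<open>One absorption lowers only the upper index, the other lowers both. Truncated subtraction
  is harmless: for j > N both sides vanish.\<close>

lemma binomial_Suc_Suc_absorb_comp:
  "(j + 1) * (N + 1 - j) * (N + 2 choose (j + 1)) = (N + 2) * (N + 1) * (N choose j)"
proof -
  have "(N + 1 - j) * (N + 2 choose (j + 1)) = (N + 2) * (N + 1 choose (j + 1))"
    using binomial_absorb_comp[of "N + 2" "j + 1"] by simp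
  moreover have "(j + 1) * (N + 1 choose (j + 1)) = (N + 1) * (N choose j)"
    using Suc_times_binomial_eq[of N j] by (simp add: mult.commute)
  ultimately show ?thesis
    by (metis mult.assoc mult.left_commute)
qed

lemma binomial_ward1_rec:
  assumes "k \<ge> 1" and "k < n"
  shows "real (binomial_ward1 n k) =
    2 * real n * (2 * real n - 1) / (real n + real k) *
      ((real n + real k - 1) / (real n - real k) * real (binomial_ward1 (n - 1) k)
        + real (binomial_ward1 (n - 1) (k - 1)))"
proof -
  obtain m l where n: "n = m + 1" and k: "k = l + 1"
    using assms by (metis Suc_eq_plus1 Suc_le_D One_nat_def order.strict_trans1 less_imp_le)
  \<comment> \<open>\<open>C\<close> and \<open>D\<close> are the binomial weights of the entries
    (n-1, k) and (n-1, k-1); their lower indices are n+k-1 and n+k-2.\<close>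
  define B C D where "B = real (2 * n choose (n + k))"
    and "C = real (2 * m choose (m + k))" and "D = real (2 * m choose (m + l))"
  have "real ((n + k) * (n - k) * (2 * n choose (n + k))) =
      real (2 * n * (2 * n - 1) * (2 * m choose (m + k)))"
    using binomial_Suc_Suc_absorb_comp[of "m + k" "2 * m"] assms by (simp add: n k)
  \<comment> \<open>Since k < n, the natural-number differences become real ones, and n-k can be
    divided by later.\<close>
  then have C: "(real n + real k) * (real n - real k) * B = 2 * real n * (2 * real n - 1) * C"
    using assms by (simp add: B_def C_def of_nat_diff)
  have "real ((n + k) * (n + k - 1) * (2 * n choose (n + k))) =
      real (2 * n * (2 * n - 1) * (2 * m choose (m + l)))"
    using binomial_Suc_Suc_absorb[of "m + l" "2 * m"] by (simp add: n k del: binomial_Suc_Suc)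
  then have D: "(real n + real k) * (real n + real k - 1) * B = 2 * real n * (2 * real n - 1) * D"
    using assms by (simp add: B_def D_def of_nat_diff)
  have "real (ward1 n k) = (real n + real k - 1) * (real (ward1 m k) + real (ward1 m l))"
    using ward1_rec[of k n] assms by (simp add: n k algebra_simps)
  \<comment> \<open>The factors are ordered so that \<open>(real n + real k - 1) * B\<close> occurs
    as a subterm only in the second summand: there it is rewritten via \<open>D\<close>, and the
    remaining \<open>B\<close> via \<open>C\<close>.\<close>
  then have "real (binomial_ward1 n k) =
      (real n + real k - 1) * real (ward1 m k) * B + (real n + real k - 1) * B * real (ward1 m l)"
    by (simp add: binomial_ward1_def B_def distrib_left mult_ac)
  also have "(real n + real k - 1) * B = 2 * real n * (2 * real n - 1) / (real n + real k) * D"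
    using D assms by (simp add: divide_simps mult_ac)
  also have "B = 2 * real n * (2 * real n - 1) / (real n + real k) * (C / (real n - real k))"
    using C assms by (simp add: divide_simps mult_ac)
  finally have "real (binomial_ward1 n k) =
      2 * real n * (2 * real n - 1) / (real n + real k) *
        ((real n + real k - 1) / (real n - real k) * (C * real (ward1 m k)) + D * real (ward1 m l))"
    by (simp add: distrib_left mult_ac)
  then show ?thesis
    by (simp add: binomial_ward1_def n k C_def D_def)
qed

theorem theorem5p2:
  shows "(\<forall>n k :: nat. n \<ge> k \<and> k \<ge> 1 \<and> n - k \<ge> 1 \<longrightarrow>
            real (binomial_ward1 n k) =
              2 * real n * (2 * real n - 1) / (real n + real k) *
                ((real n + real k - 1) / (real n - real k) * real (binomial_ward1 (n - 1) k)
                  + real (binomial_ward1 (n - 1) (k - 1))))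
       \<and> binomial_ward1 0 0 = 1
       \<and> (\<forall>n :: nat. n \<ge> 1 \<longrightarrow> binomial_ward1 n 0 = 0)
       \<and> (\<forall>k :: nat. k \<ge> 1 \<longrightarrow> binomial_ward1 0 k = 0)
       \<and> (\<forall>n k :: nat. k > n \<longrightarrow> binomial_ward1 n k = 0)"
proof (intro conjI allI impI)
  show "binomial_ward1 n 0 = 0" if "n \<ge> 1" for n
    using that by (cases n) (simp_all add: binomial_ward1_def)
qed (use binomial_ward1_rec in \<open>auto simp: binomial_ward1_def ward1_eq_0\<close>)

end
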